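(* The set $\mathcal L^+$ of all PK-realizable polynomials is closed under multiplication; that is, $\mathcal L^+$ is a multiplicative semigroup (the Liskova semigroup).
   Context: A polynomial $P(q)\in\mathbb N[q]$ with non-zero constant term is called PK-realizable if there exist a partition $\lambda$, a dominant sequence of rectangular partitions $R$, and an integer $L$ such that $P(q)=q^LK_{\lambda R}(q)$. Parabolic Kostka polynomials: for $f$ a Laurent polynomial in $x_1,\ldots,x_n$ put $\pi_n(f)=J(1)^{-1}J(f)$, $J(f)=\sum_{w\in S_n}\mathrm{sgn}(w)\,w(x^\delta f)$, $\delta=(n-1,n-2,\ldots,0)$; extend coefficientwise to power series in $q$. For a composition $\eta=(\eta_1,\ldots,\eta_p)$ of $n$ let $\Phi(\eta)$ be the set of pairs $(i,j)$ with $1\le i\le\eta_1+\cdots+\eta_u<j\le n$ for some $u$. For a partition $\mu$ with $l(\mu)\le n$, define $K_{\lambda\mu\eta}(q)$ by $$\pi_n\Bigl(x^\mu\prod_{(i,j)\in\Phi(\eta)}(1-qx_i/x_j)^{-1}\Bigr)=\sum_\lambda K_{\lambda\mu\eta}(q)\,s_\lambda(x_1,\ldots,x_n),$$ where factors are expanded as power series in $q$, $\lambda$ runs over weakly decreasing sequences in $\mathbb Z^n$, and $s_\lambda=\pi_n(x^\lambda)$. A dominant sequence of rectangular partitions is $R=(R_1,\ldots,R_p)$, $R_a=(\mu_a^{\eta_a})$ ($\eta_a$ rows of length $\mu_a$), with $\mu_1\ge\cdots\ge\mu_p$. Put $\eta(R)=(\eta_1,\ldots,\eta_p)$, $n=\sum\eta_a$,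 let $\mu(R)$ be the concatenation of the parts of $R_1,\ldots,R_p$, and define $K_{\lambda R}(q)=K_{\lambda\,\mu(R)\,\eta(R)}(q)$ (zero if $l(\lambda)>n$, where $l(\lambda)$ is the number of nonzero parts). *)

theory Defs
  imports
    "HOL-Library.Poly_Mapping"
    "HOL-Combinatorics.Permutations"
    "HOL-Computational_Algebra.Computational_Algebra"
begin

text \<open>
  Laurent polynomials over the integers in variables indexed from 0; an exponent vector is a
  finitely supported function. Only the variables with index below n are used below, so all
  indices are shifted down by one compared with the usual notation.
\<close>

type_synonym laurent = "(nat \<Rightarrow>\<^sub>0 int) \<Rightarrow>\<^sub>0 int"

definition var :: "nat \<Rightarrow> laurent"
  where "var i = Poly_Mapping.single (Poly_Mapping.single i 1) 1"

definition xpow :: "int list \<Rightarrow> laurent"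
  where "xpow a = Poly_Mapping.single (Poly_Mapping.nth a) 1"

definition var_ratio :: "nat \<Rightarrow> nat \<Rightarrow> laurent"
  where "var_ratio i j = Poly_Mapping.single (Poly_Mapping.single i 1 - Poly_Mapping.single j 1) 1"

lemma var_ratio_mult_var: "var_ratio i j * var j = var i"
  by (simp add: var_ratio_def var_def mult_single)

text \<open>
  The permutation w acts by sending the i-th variable to the w(i)-th one. The exponent of the
  i-th variable thus becomes the exponent of the w(i)-th variable; the coefficient of the new
  polynomial at b is the old coefficient at the composition of b with w.
\<close>

definition permute_vars :: "(nat \<Rightarrow> nat) \<Rightarrow> laurent \<Rightarrow> laurent"
  where "permute_vars w f = Poly_Mapping.map_key (Poly_Mapping.map_key w) f"

lemma permute_vars_single:
  assumes w: "w permutes S"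
  shows "permute_vars w (Poly_Mapping.single a c) =
    Poly_Mapping.single (Poly_Mapping.map_key (inv w) a) c"
proof -
  have inj: "inj w" "inj (inv w)"
    using w permutes_inj permutes_inv by blast+
  have ww: "w \<circ> inv w = (\<lambda>x. x)" "inv w \<circ> w = (\<lambda>x. x)"
    using permutes_inv_o[OF w] by (simp_all add: id_def)
  have l: "Poly_Mapping.map_key (inv w) (Poly_Mapping.map_key w b) = b" for b :: "nat \<Rightarrow>\<^sub>0 int"
    unfolding map_key_compose[OF inj(2,1)] ww by (rule map_key_id)
  have r: "Poly_Mapping.map_key w (Poly_Mapping.map_key (inv w) b) = b" for b :: "nat \<Rightarrow>\<^sub>0 int"
    unfolding map_key_compose[OF inj] ww by (rule map_key_id)
  have "inj (Poly_Mapping.map_key w :: (nat \<Rightarrow>\<^sub>0 int) \<Rightarrow> _)"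
    using l by (rule inj_on_inverseI)
  then have "Poly_Mapping.map_key (Poly_Mapping.map_key w)
      (Poly_Mapping.single (Poly_Mapping.map_key w (Poly_Mapping.map_key (inv w) a)) c) =
    Poly_Mapping.single (Poly_Mapping.map_key (inv w) a) c"
    by (rule map_key_single)
  then show ?thesis
    unfolding permute_vars_def r .
qed

lemma permute_vars_var:
  assumes w: "w permutes S"
  shows "permute_vars w (var i) = var (w i)"
proof -
  have "Poly_Mapping.map_key (inv w) (Poly_Mapping.single (inv w (w i)) (1::int)) = Poly_Mapping.single (w i) 1"
    using permutes_inj[OF permutes_inv[OF w]] by (rule map_key_single)
  then show ?thesis
    by (simp add: var_def permute_vars_single[OF w] permutes_inverses[OF w])
qed

definition delta :: "nat \<Rightarrow> int list"
  where "delta n = map int (rev [0..<n])"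

definition antisymmetrize :: "nat \<Rightarrow> laurent \<Rightarrow> laurent"
  where "antisymmetrize n f =
    (\<Sum>w | w permutes {..<n}. of_int (sign w) * permute_vars w (xpow (delta n) * f))"

text \<open>The quotient is formed in the field of fractions of the ring of Laurent polynomials.\<close>

definition demazure :: "nat \<Rightarrow> laurent \<Rightarrow> laurent fract"
  where "demazure n f =
    inverse (to_fract (antisymmetrize n 1)) * to_fract (antisymmetrize n f)"

definition dominant_weights :: "nat \<Rightarrow> int list set"
  where "dominant_weights n = {lam. length lam = n \<and> sorted_wrt (\<ge>) lam}"

definition schur :: "nat \<Rightarrow> int list \<Rightarrow> laurent fract"
  where "schur n lam = demazure n (xpow lam)"

text \<open>
  In 1-based notation, i is at most the partial sum of the first u parts and j exceeds it.
\<close>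

definition Phi :: "nat list \<Rightarrow> (nat \<times> nat) set"
  where "Phi \<eta> = {(i, j). \<exists>u\<in>{1..length \<eta>}.
    i < sum_list (take u \<eta>) \<and> sum_list (take u \<eta>) \<le> j \<and> j < sum_list \<eta>}"

text \<open>The expansion in q of the inverse of 1 - q c.\<close>

definition geometric :: "laurent \<Rightarrow> laurent fps"
  where "geometric c = Abs_fps (\<lambda>k. c ^ k)"

lemma geometric_mult: "(1 - fps_X * fps_const c) * geometric c = 1"
proof -
  have "geometric c = 1 + fps_X * (fps_const c * geometric c)"
  proof (rule fps_ext)
    fix k
    show "geometric c $ k = (1 + fps_X * (fps_const c * geometric c)) $ k"
      by (cases k) (simp_all add: geometric_def)
  qed
  then show ?thesis
    by (simp add: left_diff_distrib mult.assoc diff_eq_eq)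
qed

definition kostka_generating :: "nat list \<Rightarrow> nat list \<Rightarrow> laurent fps"
  where "kostka_generating \<mu> \<eta> =
    fps_const (xpow (map int \<mu>)) * (\<Prod>(i, j)\<in>Phi \<eta>. geometric (var_ratio i j))"

text \<open>
  The defining expansion, read coefficientwise in q: in each degree d only finitely many dominant
  weights contribute. As the Schur functions of dominant weights are linearly independent and span
  the image of the Demazure operator, exactly one family K has this property.
\<close>

definition is_kostka_family :: "nat list \<Rightarrow> nat list \<Rightarrow> (int list \<Rightarrow> int fps) \<Rightarrow> bool"
  where "is_kostka_family \<mu> \<eta> K \<longleftrightarrow> (let n = sum_list \<eta> in
    (\<forall>lam. lam \<notin> dominant_weights n \<longrightarrow> K lam = 0) \<and>
    (\<forall>d. finite {lam. K lam $ d \<noteq> 0} \<and>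
      demazure n (kostka_generating \<mu> \<eta> $ d) =
        (\<Sum>lam | K lam $ d \<noteq> 0. of_int (K lam $ d) * schur n lam)))"

definition parabolic_kostka :: "nat list \<Rightarrow> nat list \<Rightarrow> int list \<Rightarrow> int fps"
  where "parabolic_kostka \<mu> \<eta> = (THE K. is_kostka_family \<mu> \<eta> K)"

text \<open>Partitions are lists of their (positive) parts, so the length is the list length.\<close>

definition is_partition :: "nat list \<Rightarrow> bool"
  where "is_partition lam \<longleftrightarrow> sorted_wrt (\<ge>) lam \<and> 0 \<notin> set lam"

definition rectangular :: "nat list \<Rightarrow> bool"
  where "rectangular r \<longleftrightarrow> (\<exists>h>0. \<exists>m>0. r = replicate h m)"

definition dominant_rectangles :: "nat list list \<Rightarrow> bool"
  where "dominant_rectangles R \<longleftrightarrow>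
    (\<forall>r\<in>set R. rectangular r) \<and> sorted_wrt (\<ge>) (map hd R)"

definition rect_kostka :: "nat list \<Rightarrow> nat list list \<Rightarrow> int fps"
  where "rect_kostka lam R = (let \<eta> = map length R; n = sum_list \<eta> in
    if length lam \<le> n
    then parabolic_kostka (concat R) \<eta> (map int lam @ replicate (n - length lam) 0)
    else 0)"

text \<open>The exponent L may be negative, so the identity is stated between Laurent series.\<close>

definition PK_realizable :: "nat poly \<Rightarrow> bool"
  where "PK_realizable P \<longleftrightarrow> coeff P 0 \<noteq> 0 \<and>
    (\<exists>lam R L. is_partition lam \<and> dominant_rectangles R \<and>
      fps_to_fls (fps_of_poly (map_poly int P)) = fls_X_intpow L * fps_to_fls (rect_kostka lam R))"

definition liskova :: "nat poly set"
  where "liskova = {P. PK_realizable P}"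

end

theory Submission
  imports Defs
begin

text \<open>
  The product of two nonzero polynomials of type \<open>K\<^sub>\<lambda>\<^sub>R\<close> is again one, with no power of \<open>q\<close> to add. Let the
  first one belong to a partition \<open>\<lambda>\<close> and rectangles \<open>R\<close> with \<open>m\<close> rows in total, the second one to \<open>\<lambda>'\<close>
  and \<open>R'\<close>. For a large \<open>N\<close>, add \<open>N\<close> to the \<open>m\<close> (possibly zero) parts of \<open>\<lambda>\<close>, widen each rectangle of \<open>R\<close>
  by \<open>N\<close> columns, and concatenate with \<open>\<lambda>'\<close> and \<open>R'\<close>. The result is again a partition with a dominant
  sequence of rectangles, and its polynomial is the product of the two given ones.

  To see this, a parabolic Kostka polynomial is written as an alternating sum: the coefficient of
  \<open>s\<^sub>\<lambda>\<close> is the coefficient of \<open>x^(\<lambda> + \<delta>)\<close> in the antisymmetrized generating function, because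
  antisymmetrized dominant monomials are dual to coefficients at strictly decreasing exponents
  (\<open>lookup_antisymmetrize_dominant\<close>, \<open>antisymmetrize_expansion\<close>). For the concatenated data, the
  generating function is that of the first block times that of the second one, in its own
  variables, times the factors for cross roots \<open>x\<^sub>i / x\<^sub>j\<close> with \<open>i\<close> in the first and \<open>j\<close> in the second
  block (\<open>kostka_generating_append\<close>). Consider the degree in the first \<open>m\<close> variables. Cross roots can
  only increase it (\<open>lookup_mult_minimal_degree\<close>), while permuting the strictly decreasing
  sequence \<open>\<lambda> + \<delta>\<close> can only decrease it, strictly unless the permutation preserves the blocks
  (\<open>degree_upto_act\<close>). Since a nonzero polynomial forces \<open>\<lambda>\<close> and \<open>R\<close> to have the same size, both bounds
  coincide: neither cross roots nor mixing permutations contribute, and the alternating sum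
  factors (\<open>parabolic_kostka_append\<close>).
\<close>

section \<open>Coefficients of antisymmetrized Laurent polynomials\<close>

abbreviation lookup :: "('a \<Rightarrow>\<^sub>0 'b::zero) \<Rightarrow> 'a \<Rightarrow> 'b" where "lookup \<equiv> Poly_Mapping.lookup"
abbreviation keys :: "('a \<Rightarrow>\<^sub>0 'b::zero) \<Rightarrow> 'a set" where "keys \<equiv> Poly_Mapping.keys"
abbreviation vec :: "int list \<Rightarrow> (nat \<Rightarrow>\<^sub>0 int)" where "vec \<equiv> Poly_Mapping.nth"
abbreviation act :: "(nat \<Rightarrow> nat) \<Rightarrow> (nat \<Rightarrow>\<^sub>0 int) \<Rightarrow> (nat \<Rightarrow>\<^sub>0 int)" where "act \<equiv> Poly_Mapping.map_key"

lemma lookup_vec: "lookup (vec xs) i = (if i < length xs then xs ! i else 0)"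
  by (simp add: nth_default_def)

declare lookup_nth [simp del] keys_nth [simp del]

lemma length_delta [simp]: "length (delta n) = n"
  by (simp add: delta_def)

lemma nth_delta [simp]: "i < n \<Longrightarrow> delta n ! i = int (n - 1 - i)"
  by (simp add: delta_def rev_nth)

lemma vec_inject: "length xs = length ys \<Longrightarrow> vec xs = vec ys \<longleftrightarrow> xs = ys"
  by (metis lookup_vec nth_equalityI)

lemma lookup_act: "w permutes S \<Longrightarrow> lookup (act w b) i = lookup b (w i)"
  by (simp add: map_key.rep_eq permutes_inj)

lemma act_act: "v permutes S \<Longrightarrow> w permutes T \<Longrightarrow> act w (act v b) = act (v \<circ> w) b"
  by (simp add: map_key_compose permutes_inj)

lemma act_inv:
  assumes w: "w permutes S"
  shows "act (inv w) (act w b) = b"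
  by (rule poly_mapping_eqI)
    (simp add: lookup_act[OF w] lookup_act[OF permutes_inv[OF w]] permutes_inverses[OF w])

lemma inj_act: "w permutes S \<Longrightarrow> inj (act w)"
  by (metis act_inv injI)

lemma lookup_permute_vars:
  "w permutes S \<Longrightarrow> lookup (permute_vars w f) b = lookup f (act w b)"
  unfolding permute_vars_def by (simp add: map_key.rep_eq inj_act)

lemma lookup_single_one_mult:
  fixes a :: "'a::ab_group_add" and f :: "'a \<Rightarrow>\<^sub>0 'b::comm_ring_1"
  shows "lookup (Poly_Mapping.single a 1 * f) b = lookup f (b - a)"
proof -
  have "lookup (Poly_Mapping.single a 1 * f) b = (\<Sum>l. ((\<Sum>q. lookup f q when b = l + q) when a = l))"
    by (simp add: lookup_mult lookup_single when_mult)
  also have "\<dots> = (\<Sum>q. lookup f q when b = a + q)"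
    by simp
  also have "\<dots> = (\<Sum>q. lookup f q when b - a = q)"
    by (rule Sum_any.cong) (auto simp: when_def algebra_simps)
  finally show ?thesis by simp
qed

lemma lookup_of_int_mult:
  fixes f :: laurent
  shows "lookup (of_int c * f) b = c * lookup f b"
  by (induction c rule: int_induct[of _ 0]) (simp_all add: algebra_simps lookup_add lookup_minus)

lemma lookup_antisymmetrize:
  "lookup (antisymmetrize n f) b =
    (\<Sum>w | w permutes {..<n}. sign w * lookup f (act w b - vec (delta n)))"
  unfolding antisymmetrize_def lookup_sum
  by (rule sum.cong) (auto simp: lookup_of_int_mult lookup_permute_vars xpow_def lookup_single_one_mult)

lemma lookup_antisymmetrize_act:
  assumes v: "v permutes {..<n}"
  shows "lookup (antisymmetrize n f) (act v b) = sign v * lookup (antisymmetrize n f) b"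
proof -
  have "sign v * lookup (antisymmetrize n f) b =
    (\<Sum>w | w permutes {..<n}. sign v * (sign w * lookup f (act w b - vec (delta n))))"
    by (simp add: lookup_antisymmetrize sum_distrib_left)
  also have "\<dots> = (\<Sum>w | w permutes {..<n}. sign v * (sign (v \<circ> w) * lookup f (act (v \<circ> w) b - vec (delta n))))"
    by (rule setum_permutations_compose_left[OF v])
  also have "\<dots> = lookup (antisymmetrize n f) (act v b)"
    unfolding lookup_antisymmetrize
  proof (rule sum.cong, goal_cases)
    case (2 w)
    then have w: "w permutes {..<n}" by simp
    have "sign (v \<circ> w) = sign v * sign w"
      using v w by (intro sign_compose) (auto simp: permutation_permutes)
    then have "sign v * (sign (v \<circ> w) * x) = (sign v * sign v) * (sign w * x)" for x
      by simp
    then show ?case using act_act[OF v w] by simp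
  qed simp
  finally show ?thesis by simp
qed

abbreviation shifted_weight :: "nat \<Rightarrow> int list \<Rightarrow> (nat \<Rightarrow>\<^sub>0 int)"
  where "shifted_weight n lam \<equiv> vec lam + vec (delta n)"

text \<open>
  Adding delta turns the weakly decreasing sequences of integers into the strictly decreasing ones.
  As these have trivial stabilizer, each dominant weight labels one regular orbit of exponents.
\<close>

lemma shifted_weight_strict:
  assumes "lam \<in> dominant_weights n" "i < j" "j < n"
  shows "lookup (shifted_weight n lam) i > lookup (shifted_weight n lam) j"
proof -
  have "lam ! i \<ge> lam ! j"
    using assms by (auto simp: dominant_weights_def sorted_wrt_iff_nth_less)
  then show ?thesis
    using assms by (auto simp: dominant_weights_def lookup_add lookup_vec)
qed

lemma shifted_weight_inject:
  assumes "lam \<in> dominant_weights n" "lam' \<in> dominant_weights n"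
  shows "shifted_weight n lam = shifted_weight n lam' \<longleftrightarrow> lam = lam'"
  using assms by (simp add: vec_inject dominant_weights_def)

lemma shifted_weight_exists:
  fixes b :: "nat \<Rightarrow>\<^sub>0 int"
  assumes "keys b \<subseteq> {..<n}" and "\<And>i j. i < j \<Longrightarrow> j < n \<Longrightarrow> lookup b i > lookup b j"
  obtains lam where "lam \<in> dominant_weights n" "b = shifted_weight n lam"
proof
  let ?lam = "map (\<lambda>i. lookup b i - int (n - 1 - i)) [0..<n]"
  have "lookup b j + int (j - i) \<le> lookup b i" if "i \<le> j" "j < n" for i j
    using that
  proof (induction j)
    case (Suc j)
    show ?case
    proof (cases "i = Suc j")
      case False
      then have "i \<le> j" "lookup b j > lookup b (Suc j)" using Suc.prems assms(2)[of j "Suc j"] by auto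
      with Suc show ?thesis by (simp add: Suc_diff_le)
    qed simp
  qed simp
  from this[OF less_imp_le] show "?lam \<in> dominant_weights n"
    by (force simp: dominant_weights_def sorted_wrt_iff_nth_less of_nat_diff)
  show "b = shifted_weight n ?lam"
    using assms(1) by (intro poly_mapping_eqI)
      (auto simp: lookup_add lookup_vec in_keys_iff subset_iff)
qed

text \<open>
  An increasing injection moves no index down; a largest index that is moved up would be sent to an
  index that is fixed.
\<close>

lemma strict_mono_permutes_id:
  fixes w :: "nat \<Rightarrow> nat"
  assumes w: "w permutes {..<n}" and "\<And>i j. i < j \<Longrightarrow> j < n \<Longrightarrow> w i < w j"
  shows "w = id"
proof -
  have ge: "i \<le> w i" if "i < n" for i
    using that
  proof (induction i)
    case (Suc i)
    then show ?case using assms(2)[of i "Suc i"] by simp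
  qed simp
  have "w i = i" if "i < n" for i
    using that
  proof (induction "n - i" arbitrary: i rule: less_induct)
    case less
    show ?case
    proof (rule ccontr)
      assume "w i \<noteq> i"
      then have "w i > i" using ge less.prems by fastforce
      moreover have "w i < n" using w less.prems permutes_in_image by fastforce
      ultimately have "w (w i) = w i" by (intro less.hyps) auto
      then show False using \<open>w i \<noteq> i\<close> permutes_inj[OF w] by (auto dest: injD)
    qed
  qed
  then show ?thesis using w by (auto simp: fun_eq_iff permutes_def)
qed

text \<open>
  Two strictly decreasing sequences that differ by a permutation are equal, and the permutation is
  the identity. So the antisymmetrized dominant monomials are dual to the coefficients at the
  exponents \<open>\<lambda> + \<delta>\<close>: this gives their linear independence and the multiplicities in any expansion.
\<close>

lemma lookup_antisymmetrize_dominant: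
  assumes lam: "lam \<in> dominant_weights n" and lam': "lam' \<in> dominant_weights n"
  shows "lookup (antisymmetrize n (xpow lam')) (shifted_weight n lam) = (if lam = lam' then 1 else 0)"
proof -
  let ?b = "shifted_weight n lam" and ?b' = "shifted_weight n lam'"
  have iff: "act w ?b - vec (delta n) = vec lam' \<longleftrightarrow> w = id \<and> lam = lam'" if w: "w permutes {..<n}" for w
  proof
    assume "act w ?b - vec (delta n) = vec lam'"
    then have eq: "act w ?b = ?b'" by (simp add: algebra_simps)
    have "w = id"
    proof (rule strict_mono_permutes_id[OF w])
      fix i j assume ij: "i < j" "j < n"
      then have "lookup ?b (w i) > lookup ?b (w j)"
        using shifted_weight_strict[OF lam' ij] by (simp only: eq[symmetric] lookup_act[OF w])
      moreover have "w i < n" using w ij permutes_in_image by fastforce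
      ultimately show "w i < w j"
        using shifted_weight_strict[OF lam, of "w j" "w i"] by (cases "w i" "w j" rule: linorder_cases) auto
    qed
    with eq show "w = id \<and> lam = lam'"
      using shifted_weight_inject[OF lam lam'] by (simp add: id_def map_key_id)
  next
    assume "w = id \<and> lam = lam'"
    then show "act w ?b - vec (delta n) = vec lam'"
      by (simp add: id_def map_key_id)
  qed
  have "lookup (antisymmetrize n (xpow lam')) ?b =
    (\<Sum>w | w permutes {..<n}. if w = id then (if lam = lam' then 1 else 0) else 0)"
    unfolding lookup_antisymmetrize
  proof (rule sum.cong, goal_cases)
    case (2 w)
    then show ?case
      using iff[of w] by (auto simp: xpow_def lookup_single when_def dest: sym)
  qed simp
  also have "\<dots> = (if lam = lam' then 1 else 0)"
    by (subst sum.delta) (auto simp: finite_permutations permutes_id)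
  finally show ?thesis .
qed

lemma antisymmetrize_one_nonzero: "antisymmetrize n 1 \<noteq> 0"
proof -
  have "vec (replicate n 0) = 0" by (auto intro!: poly_mapping_eqI simp: lookup_vec)
  then have "xpow (replicate n 0) = 1" by (simp add: xpow_def)
  moreover have "replicate n 0 \<in> dominant_weights n"
    by (simp add: dominant_weights_def sorted_wrt_iff_nth_less)
  ultimately have "lookup (antisymmetrize n 1) (shifted_weight n (replicate n 0)) = 1"
    using lookup_antisymmetrize_dominant by metis
  then show ?thesis by auto
qed

lemma keys_act:
  assumes w: "w permutes {..<n}"
  shows "keys (act w b) \<subseteq> {..<n} \<longleftrightarrow> keys b \<subseteq> {..<n}"
proof -
  have "keys (act w b) = w -` keys b"
    by (simp add: keys_map_key permutes_inj[OF w])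
  moreover have "{..<n} = w -` {..<n}"
    using w by (simp add: permutes_vimage)
  moreover have "w ` (w -` A) = A" for A
    using permutes_surj[OF w] by (simp add: surj_image_vimage_eq)
  ultimately show ?thesis
    by (metis image_mono vimage_mono)
qed

lemma keys_vec: "keys (vec xs) \<subseteq> {..<length xs}"
  by (auto simp: in_keys_iff lookup_vec split: if_splits)

lemma keys_delta: "keys (vec (delta n)) \<subseteq> {..<n}"
  using keys_vec[of "delta n"] by (simp add: delta_def)

lemma lookup_antisymmetrize_outside:
  fixes b :: "nat \<Rightarrow>\<^sub>0 int"
  assumes f: "\<And>a. a \<in> keys f \<Longrightarrow> keys a \<subseteq> {..<n}" and b: "\<not> keys b \<subseteq> {..<n}"
  shows "lookup (antisymmetrize n f) b = 0"
  unfolding lookup_antisymmetrize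
proof (intro sum.neutral ballI)
  fix w assume "w \<in> {w. w permutes {..<n}}"
  then have w: "w permutes {..<n}" by simp
  have "lookup f (act w b - vec (delta n)) = 0"
  proof (rule ccontr)
    assume "lookup f (act w b - vec (delta n)) \<noteq> 0"
    then have "keys (act w b - vec (delta n)) \<subseteq> {..<n}" using f by (simp add: in_keys_iff)
    then have "keys (act w b) \<subseteq> {..<n}"
      using keys_delta[of n] keys_add[of "act w b - vec (delta n)" "vec (delta n)"] by auto
    with b keys_act[OF w] show False by blast
  qed
  then show "sign w * lookup f (act w b - vec (delta n)) = 0" by simp
qed

lemma sorting_permutation:
  fixes f :: "nat \<Rightarrow> int"
  assumes "inj_on f {..<n}"
  obtains w where "w permutes {..<n}" "\<And>i j. i < j \<Longrightarrow> j < n \<Longrightarrow> f (w i) > f (w j)"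
proof -
  define xs where "xs = sorted_list_of_set (f ` {..<n})"
  have xs: "sorted_wrt (<) xs" "set xs = f ` {..<n}" "length xs = n"
    using assms sorted_list_of_set.strict_sorted_key_list_of_set by (auto simp: xs_def card_image)
  define v where "v i = (if i < n then inv_into {..<n} f (xs ! (n - 1 - i)) else i)" for i
  have mem: "xs ! (n - 1 - i) \<in> f ` {..<n}" if "i < n" for i
    using that xs(3) nth_mem[of "n - 1 - i" xs] unfolding xs(2) by simp
  have fv: "f (v i) = xs ! (n - 1 - i)" if "i < n" for i
    using mem[OF that] that by (simp add: v_def f_inv_into_f)
  have dec: "f (v i) > f (v j)" if "i < j" "j < n" for i j
    using that xs by (simp add: fv sorted_wrt_iff_nth_less)
  have "inj_on v {..<n}"
    by (rule linorder_inj_onI) (use dec in force)+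
  moreover have "v ` {..<n} \<subseteq> {..<n}"
    using mem inv_into_into[of _ f "{..<n}"] by (force simp: v_def)
  ultimately have "bij_betw v {..<n} {..<n}"
    by (simp add: bij_betw_def endo_inj_surj)
  then have "v permutes {..<n}"
    by (rule bij_imp_permutes) (simp add: v_def)
  from this dec show thesis by (rule that)
qed

text \<open>
  Both sides are alternating, so it is enough to compare their coefficients at one exponent of each
  orbit. If two entries of the exponent agree, a transposition forces the coefficient to vanish;
  otherwise the orbit contains a strictly decreasing exponent \<open>\<lambda> + \<delta>\<close>, and duality applies.
\<close>

lemma antisymmetrize_expansion:
  assumes f: "\<And>a. a \<in> keys f \<Longrightarrow> keys a \<subseteq> {..<n}"
  defines "k \<equiv> \<lambda>lam. if lam \<in> dominant_weights n then lookup (antisymmetrize n f) (shifted_weight n lam) else 0"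
  shows "finite {lam. k lam \<noteq> 0}"
    and "antisymmetrize n f = (\<Sum>lam | k lam \<noteq> 0. of_int (k lam) * antisymmetrize n (xpow lam))"
proof -
  have "shifted_weight n ` {lam. k lam \<noteq> 0} \<subseteq> keys (antisymmetrize n f)"
    by (auto simp: k_def in_keys_iff)
  moreover have "inj_on (shifted_weight n) {lam. k lam \<noteq> 0}"
    using shifted_weight_inject by (auto simp: inj_on_def k_def split: if_splits)
  ultimately show fin: "finite {lam. k lam \<noteq> 0}"
    by (meson finite_imageD finite_keys finite_subset)
  let ?G = "\<Sum>lam | k lam \<noteq> 0. of_int (k lam) * antisymmetrize n (xpow lam)"
  have lG: "lookup ?G b = (\<Sum>lam | k lam \<noteq> 0. k lam * lookup (antisymmetrize n (xpow lam)) b)" for b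
    by (simp add: lookup_sum lookup_of_int_mult)
  have Gact: "lookup ?G (act v b) = sign v * lookup ?G b" if "v permutes {..<n}" for v b
    unfolding lG by (simp add: lookup_antisymmetrize_act[OF that] sum_distrib_left mult_ac)
  have dom: "lookup ?G (shifted_weight n lam) = lookup (antisymmetrize n f) (shifted_weight n lam)"
    if "lam \<in> dominant_weights n" for lam
  proof -
    have "lookup ?G (shifted_weight n lam) = (\<Sum>lam' | k lam' \<noteq> 0. if lam = lam' then k lam' else 0)"
      unfolding lG using that
      by (intro sum.cong refl) (simp add: lookup_antisymmetrize_dominant k_def split: if_splits)
    also have "\<dots> = k lam" using fin by (simp add: sum.delta')
    finally show ?thesis using that by (simp add: k_def)
  qed
  show "antisymmetrize n f = ?G"
  proof (rule poly_mapping_eqI)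
    fix b :: "nat \<Rightarrow>\<^sub>0 int"
    consider "\<not> keys b \<subseteq> {..<n}" | "keys b \<subseteq> {..<n}" "inj_on (lookup b) {..<n}"
      | "\<not> inj_on (lookup b) {..<n}" by blast
    then show "lookup (antisymmetrize n f) b = lookup ?G b"
    proof cases
      case 1
      have "lookup (antisymmetrize n (xpow lam)) b = 0" if "k lam \<noteq> 0" for lam
      proof (rule lookup_antisymmetrize_outside[OF _ 1])
        fix a assume "a \<in> keys (xpow lam)"
        then have "a = vec lam" by (simp add: xpow_def)
        moreover have "length lam = n" using that by (auto simp: k_def dominant_weights_def split: if_splits)
        ultimately show "keys a \<subseteq> {..<n}" using keys_vec by blast
      qed
      then show ?thesis unfolding lG using lookup_antisymmetrize_outside[OF f 1] by simp
    next
      case 2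
      from sorting_permutation[OF 2(2)] obtain w where w: "w permutes {..<n}"
        "\<And>i j. i < j \<Longrightarrow> j < n \<Longrightarrow> lookup b (w i) > lookup b (w j)" by blast
      then obtain lam where lam: "lam \<in> dominant_weights n" "act w b = shifted_weight n lam"
        using 2(1) keys_act[OF w(1), of b] lookup_act[OF w(1), of b]
        by (metis shifted_weight_exists[of "act w b" n])
      have "sign w * lookup (antisymmetrize n f) b = sign w * lookup ?G b"
        using dom[OF lam(1)] Gact[OF w(1), of b] lookup_antisymmetrize_act[OF w(1), of f b] lam(2) by simp
      then show ?thesis by (cases w rule: sign_cases) auto
    next
      case 3
      then obtain i j where ij: "i < n" "j < n" "i \<noteq> j" "lookup b i = lookup b j"
        by (auto simp: inj_on_def)
      let ?t = "Transposition.transpose i j"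
      have t: "?t permutes {..<n}" using ij by (intro permutes_swap_id) auto
      have "act ?t b = b"
        using ij by (intro poly_mapping_eqI) (auto simp: lookup_act[OF t] Transposition.transpose_def)
      then show ?thesis
        using Gact[OF t, of b] lookup_antisymmetrize_act[OF t, of f b] ij by (simp add: sign_swap_id)
    qed
  qed
qed

section \<open>Parabolic Kostka polynomials as alternating sums\<close>

lemma to_fract_sum: "to_fract (sum f A) = (\<Sum>x\<in>A. to_fract (f x))"
  by (induction A rule: infinite_finite_induct) auto

lemma to_fract_of_int: "to_fract (of_int c) = of_int c"
  by (induction c rule: int_induct[of _ 0]) (simp_all)

text \<open>
  Clearing the common denominator moves the defining expansion from the field of fractions into the
  ring of Laurent polynomials.
\<close>

lemma demazure_eq_schur_sum_iff:
  "demazure n f = (\<Sum>lam\<in>A. of_int (k lam) * schur n lam) \<longleftrightarrow>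
   antisymmetrize n f = (\<Sum>lam\<in>A. of_int (k lam) * antisymmetrize n (xpow lam))" (is "_ \<longleftrightarrow> _ = ?S")
proof -
  let ?a = "to_fract (antisymmetrize n 1)"
  have "(\<Sum>lam\<in>A. of_int (k lam) * schur n lam) = inverse ?a * to_fract ?S"
    by (simp add: schur_def demazure_def to_fract_sum to_fract_of_int sum_distrib_left mult_ac)
  moreover have "inverse ?a \<noteq> 0" using antisymmetrize_one_nonzero by simp
  ultimately show ?thesis
    by (simp only: demazure_def mult_cancel_left to_fract_eq_iff) simp
qed

lemma is_kostka_family_nth:
  assumes K: "is_kostka_family \<mu> \<eta> K" and n: "n = sum_list \<eta>" and lam: "lam \<in> dominant_weights n"
  shows "K lam $ d = lookup (antisymmetrize n (kostka_generating \<mu> \<eta> $ d)) (shifted_weight n lam)"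
proof -
  let ?A = "{lam. K lam $ d \<noteq> 0}"
  have fin: "finite ?A" and dom: "\<And>lam'. lam' \<in> ?A \<Longrightarrow> lam' \<in> dominant_weights n"
    and eq: "antisymmetrize n (kostka_generating \<mu> \<eta> $ d) =
      (\<Sum>lam\<in>?A. of_int (K lam $ d) * antisymmetrize n (xpow lam))"
    using K unfolding is_kostka_family_def Let_def n[symmetric] demazure_eq_schur_sum_iff by auto
  have "lookup (antisymmetrize n (kostka_generating \<mu> \<eta> $ d)) (shifted_weight n lam) =
      (\<Sum>lam'\<in>?A. if lam = lam' then K lam' $ d else 0)"
    unfolding eq lookup_sum using dom lam
    by (intro sum.cong refl) (simp add: lookup_of_int_mult lookup_antisymmetrize_dominant)
  also have "\<dots> = K lam $ d" using fin by (simp add: sum.delta')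
  finally show ?thesis ..
qed

text \<open>
  The allowed set varies with the power of \<open>q\<close> because a factor for cross roots raises the degree in
  the first variables by exactly this power; constant families express bounds on the support and
  homogeneity.
\<close>

definition weights_in :: "(nat \<Rightarrow> (nat \<Rightarrow>\<^sub>0 int) set) \<Rightarrow> laurent fps \<Rightarrow> bool"
  where "weights_in C F \<longleftrightarrow> (\<forall>d. keys (F $ d) \<subseteq> C d)"

lemma weights_in_mult:
  assumes "weights_in C F" "weights_in D G"
    and "\<And>i j a b. a \<in> C i \<Longrightarrow> b \<in> D j \<Longrightarrow> a + b \<in> E (i + j)"
  shows "weights_in E (F * G)"
  unfolding weights_in_def
proof (intro allI subsetI)
  fix d c assume "c \<in> keys ((F * G) $ d)"
  then obtain i where i: "i \<le> d" "c \<in> keys (F $ i * G $ (d - i))"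
    unfolding fps_mult_nth using keys_sum[of "\<lambda>i. F $ i * G $ (d - i)" "{0..d}"] by auto
  then obtain a b where "c = a + b" "a \<in> keys (F $ i)" "b \<in> keys (G $ (d - i))"
    using keys_mult by blast
  moreover from this have "a \<in> C i" "b \<in> D (d - i)"
    using assms(1,2) by (auto simp: weights_in_def)
  ultimately show "c \<in> E d" using assms(3)[of a i b "d - i"] i(1) by simp
qed

definition graded_monoid :: "(nat \<Rightarrow> (nat \<Rightarrow>\<^sub>0 int) set) \<Rightarrow> bool"
  where "graded_monoid C \<longleftrightarrow> 0 \<in> C 0 \<and> (\<forall>i j. \<forall>a\<in>C i. \<forall>b\<in>C j. a + b \<in> C (i + j))"

lemma weights_in_geometric:
  assumes C: "graded_monoid C" and r: "keys r \<subseteq> C 1"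
  shows "weights_in C (geometric r)"
proof -
  have "keys (r ^ d) \<subseteq> C d" for d
  proof (induction d)
    case (Suc d)
    show ?case
    proof
      fix c assume "c \<in> keys (r ^ Suc d)"
      then obtain a b where "c = a + b" "a \<in> keys r" "b \<in> keys (r ^ d)"
        using keys_mult[of r "r ^ d"] by auto
      then show "c \<in> C (Suc d)"
        using C r Suc.IH unfolding graded_monoid_def by (metis plus_1_eq_Suc subsetD)
    qed
  qed (use C in \<open>simp add: graded_monoid_def\<close>)
  then show ?thesis by (simp add: weights_in_def geometric_def)
qed

lemma weights_in_prod_geometric:
  assumes C: "graded_monoid C"
    and P: "\<And>i j. (i, j) \<in> P \<Longrightarrow> Poly_Mapping.single i 1 - Poly_Mapping.single j 1 \<in> C 1"
  shows "weights_in C (\<Prod>(i, j)\<in>P. geometric (var_ratio i j))"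
  using P
proof (induction P rule: infinite_finite_induct)
  case (insert p P)
  obtain i j where p: "p = (i, j)" by (cases p)
  have "weights_in C (geometric (var_ratio i j))"
    using insert.prems p by (intro weights_in_geometric[OF C]) (simp add: var_ratio_def)
  moreover have "weights_in C (\<Prod>(i, j)\<in>P. geometric (var_ratio i j))"
    using insert by blast
  ultimately show ?case
    using insert.hyps p C by (auto intro!: weights_in_mult[of C _ C _ C] simp: graded_monoid_def)
qed (use C in \<open>auto simp: weights_in_def graded_monoid_def\<close>)

definition degree_upto :: "nat \<Rightarrow> (nat \<Rightarrow>\<^sub>0 int) \<Rightarrow> int"
  where "degree_upto m a = (\<Sum>i<m. lookup a i)"

lemma degree_upto_simps [simp]:
  "degree_upto m 0 = 0"
  "degree_upto m (a + b) = degree_upto m a + degree_upto m b"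
  "degree_upto m (a - b) = degree_upto m a - degree_upto m b"
  "degree_upto m (Poly_Mapping.single i c) = (if i < m then c else 0)"
  by (simp_all add: degree_upto_def lookup_add lookup_minus sum.distrib sum_subtractf lookup_single when_def)

lemma Phi_less: "(i, j) \<in> Phi \<eta> \<Longrightarrow> i < sum_list \<eta> \<and> j < sum_list \<eta>"
  by (auto simp: Phi_def)

lemma finite_Phi: "finite (Phi \<eta>)"
  by (rule finite_subset[of _ "{..<sum_list \<eta>} \<times> {..<sum_list \<eta>}"]) (auto dest: Phi_less)

text \<open>
  A root \<open>x\<^sub>i / x\<^sub>j\<close> has total degree 0, so all exponents keep the degree of \<open>\<mu>\<close>.
\<close>

lemma weights_in_kostka_generating:
  assumes "length \<mu> = sum_list \<eta>"
  shows "weights_in (\<lambda>_. {a. keys a \<subseteq> {..<sum_list \<eta>} \<and> degree_upto (sum_list \<eta>) a = int (sum_list \<mu>)})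
    (kostka_generating \<mu> \<eta>)"
proof -
  let ?n = "sum_list \<eta>"
  let ?C = "\<lambda>_. {a. keys a \<subseteq> {..<?n} \<and> degree_upto ?n a = 0}"
  let ?v = "vec (map int \<mu>)"
  have add: "keys (a + b) \<subseteq> {..<?n}" if "keys a \<subseteq> {..<?n}" "keys b \<subseteq> {..<?n}" for a b :: "nat \<Rightarrow>\<^sub>0 int"
    using that keys_add[of a b] by blast
  have "graded_monoid ?C" using add by (auto simp: graded_monoid_def)
  moreover have "Poly_Mapping.single i 1 - Poly_Mapping.single j 1 \<in> ?C 1" if "(i, j) \<in> Phi \<eta>" for i j
    using Phi_less[OF that] keys_diff[of "Poly_Mapping.single i (1::int)" "Poly_Mapping.single j 1"] by auto
  ultimately have "weights_in ?C (\<Prod>(i, j)\<in>Phi \<eta>. geometric (var_ratio i j))"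
    by (rule weights_in_prod_geometric)
  moreover have "weights_in (\<lambda>_. {?v}) (fps_const (xpow (map int \<mu>)))"
    by (auto simp: weights_in_def xpow_def)
  moreover have "keys ?v \<subseteq> {..<?n}" using keys_vec[of "map int \<mu>"] assms by simp
  moreover have "degree_upto ?n ?v = int (sum_list \<mu>)"
    using assms by (simp add: degree_upto_def lookup_vec sum_list_sum_nth atLeast0LessThan)
  ultimately show ?thesis
    unfolding kostka_generating_def using add
    by (intro weights_in_mult[of "\<lambda>_. {?v}" _ ?C]) auto
qed

text \<open>
  The definite description is justified: duality determines the family, and the expansion of
  alternating Laurent polynomials provides it. Hence a parabolic Kostka polynomial is the alternating
  sum that \<open>lookup_antisymmetrize\<close> gives for a coefficient of the generating function.
\<close>

lemma is_kostka_family_parabolic_kostka: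
  assumes "length \<mu> = sum_list \<eta>"
  shows "is_kostka_family \<mu> \<eta> (parabolic_kostka \<mu> \<eta>)"
proof -
  define n where "n = sum_list \<eta>"
  define G where "G d = antisymmetrize n (kostka_generating \<mu> \<eta> $ d)" for d
  define K where "K lam = (if lam \<in> dominant_weights n
    then Abs_fps (\<lambda>d. lookup (G d) (shifted_weight n lam)) else 0)" for lam
  have supp: "keys a \<subseteq> {..<n}" if "a \<in> keys (kostka_generating \<mu> \<eta> $ d)" for a d
    using weights_in_kostka_generating[OF assms] that by (auto simp: weights_in_def n_def)
  have Kd: "K lam $ d = (if lam \<in> dominant_weights n then lookup (G d) (shifted_weight n lam) else 0)" for lam d
    by (simp add: K_def)
  have expansion: "finite {lam. K lam $ d \<noteq> 0}"
    "G d = (\<Sum>lam | K lam $ d \<noteq> 0. of_int (K lam $ d) * antisymmetrize n (xpow lam))" for d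
    unfolding Kd G_def by (rule antisymmetrize_expansion[OF supp], assumption)+
  have "is_kostka_family \<mu> \<eta> K"
    unfolding is_kostka_family_def Let_def n_def[symmetric] demazure_eq_schur_sum_iff G_def[symmetric]
    proof (intro conjI allI impI)
    show "K lam = 0" if "lam \<notin> dominant_weights n" for lam using that by (simp add: K_def)
  qed (rule expansion)+
  moreover have "K' = K" if "is_kostka_family \<mu> \<eta> K'" for K'
  proof
    fix lam
    show "K' lam = K lam"
    proof (cases "lam \<in> dominant_weights n")
      case True
      then show ?thesis
        using is_kostka_family_nth[OF that n_def] by (simp add: fps_eq_iff Kd G_def)
    next
      case False
      then show ?thesis using that by (simp add: is_kostka_family_def K_def n_def Let_def)
    qed
  qed
  ultimately show ?thesis unfolding parabolic_kostka_def by (rule theI)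
qed

lemmas parabolic_kostka_nth = is_kostka_family_nth[OF is_kostka_family_parabolic_kostka refl]

section \<open>Renaming variables\<close>

text \<open>
  Transport of a finitely supported function along a map of its arguments. It serves twice: on
  exponent vectors, to rename the variables, and then on Laurent polynomials along the resulting map
  of exponent vectors.
\<close>

definition push_keys :: "('a \<Rightarrow> 'b) \<Rightarrow> ('a \<Rightarrow>\<^sub>0 int) \<Rightarrow> ('b \<Rightarrow>\<^sub>0 int)"
  where "push_keys h f = (\<Sum>x\<in>keys f. Poly_Mapping.single (h x) (lookup f x))"

lemma push_keys_eq_frag_extend:
  fixes h :: "'a \<Rightarrow> 'b"
  shows "push_keys h = frag_extend (\<lambda>x. Poly_Mapping.single (h x) 1)"
proof
  fix f
  have "frag_cmul c (Poly_Mapping.single y 1) = Poly_Mapping.single y c" for c and y :: 'b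
    by (rule poly_mapping_eqI) (simp add: lookup_single when_def)
  then show "push_keys h f = frag_extend (\<lambda>x. Poly_Mapping.single (h x) 1) f"
    by (simp add: push_keys_def frag_extend_def)
qed

lemma push_keys_single: "push_keys h (Poly_Mapping.single x c) = Poly_Mapping.single (h x) c"
  by (simp add: push_keys_def)

lemma push_keys_add: "push_keys h (f + g) = push_keys h f + push_keys h g"
  by (simp add: push_keys_eq_frag_extend frag_extend_add)

lemma push_keys_sum: "finite A \<Longrightarrow> push_keys h (\<Sum>x\<in>A. f x) = (\<Sum>x\<in>A. push_keys h (f x))"
  by (simp add: push_keys_eq_frag_extend frag_extend_sum)

lemma push_keys_diff: "push_keys h (f - g) = push_keys h f - push_keys h g"
  by (simp add: push_keys_eq_frag_extend frag_extend_diff)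

lemma sum_monomials:
  fixes f :: "'a \<Rightarrow>\<^sub>0 int"
  shows "(\<Sum>x\<in>keys f. Poly_Mapping.single x (lookup f x)) = f"
proof -
  have "push_keys (\<lambda>x. x) f = f"
    unfolding push_keys_eq_frag_extend by (rule frag_expansion[symmetric])
  then show ?thesis by (simp add: push_keys_def)
qed

lemma lookup_push_keys: "inj h \<Longrightarrow> lookup (push_keys h f) (h x) = lookup f x"
  by (simp add: push_keys_def lookup_sum lookup_single when_def inj_eq in_keys_iff)

lemma lookup_push_keys_outside: "y \<notin> range h \<Longrightarrow> lookup (push_keys h f) y = 0"
  by (auto simp: push_keys_def lookup_sum lookup_single when_def intro!: sum.neutral)

lemma push_keys_mult:
  fixes f g :: "'a::comm_monoid_add \<Rightarrow>\<^sub>0 int" and h :: "'a \<Rightarrow> 'b::comm_monoid_add"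
  assumes h: "\<And>a b. h (a + b) = h a + h b"
  shows "push_keys h (f * g) = push_keys h f * push_keys h g"
proof -
  have "push_keys h (f * g) = push_keys h
    ((\<Sum>x\<in>keys f. Poly_Mapping.single x (lookup f x)) * (\<Sum>y\<in>keys g. Poly_Mapping.single y (lookup g y)))"
    by (simp only: sum_monomials)
  also have "\<dots> = push_keys h f * push_keys h g"
    by (simp add: sum_product push_keys_sum push_keys_single mult_single h) (simp add: push_keys_def sum_product mult_single)
  finally show ?thesis .
qed

definition shift :: "nat \<Rightarrow> (nat \<Rightarrow>\<^sub>0 int) \<Rightarrow> (nat \<Rightarrow>\<^sub>0 int)"
  where "shift m = push_keys (\<lambda>i. i + m)"

lemma lookup_shift: "lookup (shift m a) i = (if i < m then 0 else lookup a (i - m))"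
proof (cases "i < m")
  case True
  then show ?thesis by (auto simp: shift_def intro!: lookup_push_keys_outside)
next
  case False
  then show ?thesis
    using lookup_push_keys[of "\<lambda>i. i + m" a "i - m"] by (simp add: shift_def inj_on_def)
qed

lemma shift_simps [simp]:
  "shift m (a + b) = shift m a + shift m b"
  "shift m (a - b) = shift m a - shift m b"
  "shift m (Poly_Mapping.single i c) = Poly_Mapping.single (i + m) c"
  by (simp_all add: shift_def push_keys_add push_keys_diff push_keys_single)

lemma inj_shift: "inj (shift m)"
proof (rule injI, rule poly_mapping_eqI)
  fix a b i assume "shift m a = shift m b"
  then have "lookup (shift m a) (i + m) = lookup (shift m b) (i + m)" by simp
  then show "lookup a i = lookup b i" by (simp add: lookup_shift)
qed

lemma vec_append: "vec (xs @ ys) = vec xs + shift (length xs) (vec ys)"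
  by (rule poly_mapping_eqI) (auto simp: lookup_add lookup_shift lookup_vec nth_append)

definition shift_fps :: "nat \<Rightarrow> laurent fps \<Rightarrow> laurent fps"
  where "shift_fps m F = Abs_fps (\<lambda>d. push_keys (shift m) (F $ d))"

lemma shift_fps_mult: "shift_fps m (F * G) = shift_fps m F * shift_fps m G"
  by (rule fps_ext) (simp add: shift_fps_def fps_mult_nth push_keys_sum push_keys_mult)

lemma shift_fps_const_xpow: "shift_fps m (fps_const (xpow a)) = fps_const (Poly_Mapping.single (shift m (vec a)) 1)"
  by (rule fps_ext, simp add: shift_fps_def xpow_def push_keys_single, simp add: push_keys_def)

lemma push_keys_shift_one: "push_keys (shift m) 1 = 1"
proof -
  have "shift m 0 = 0" by (rule poly_mapping_eqI) (simp add: lookup_shift)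
  then show ?thesis using push_keys_single[of "shift m" 0 "1::int"] by simp
qed

lemma shift_fps_one: "shift_fps m 1 = 1"
  by (rule fps_ext, simp add: shift_fps_def push_keys_shift_one, simp add: push_keys_def)

lemma shift_fps_geometric: "shift_fps m (geometric (var_ratio i j)) = geometric (var_ratio (i + m) (j + m))"
proof (rule fps_ext)
  fix d
  have "push_keys (shift m) (var_ratio i j ^ d) = var_ratio (i + m) (j + m) ^ d"
  proof (induction d)
    case (Suc d)
    then show ?case by (simp add: push_keys_mult) (simp add: var_ratio_def push_keys_single)
  qed (simp add: push_keys_shift_one)
  then show "shift_fps m (geometric (var_ratio i j)) $ d = geometric (var_ratio (i + m) (j + m)) $ d"
    by (simp add: shift_fps_def geometric_def)
qed

lemma shift_fps_prod_geometric:
  "shift_fps m (\<Prod>(i, j)\<in>P. geometric (var_ratio i j)) =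
    (\<Prod>(i, j)\<in>P. geometric (var_ratio (i + m) (j + m)))"
  by (induction P rule: infinite_finite_induct)
    (auto simp: shift_fps_one shift_fps_mult shift_fps_geometric)

text \<open>
  For polynomials in disjoint sets of variables, an exponent splits in one way only into an exponent
  of each factor, so the convolution in the coefficient of a product has a single term.
\<close>

lemma lookup_mult_shift:
  fixes f g :: laurent
  assumes f: "\<And>a. a \<in> keys f \<Longrightarrow> keys a \<subseteq> {..<m}" and a: "keys a \<subseteq> {..<m}"
  shows "lookup (f * push_keys (shift m) g) (a + shift m b) = lookup f a * lookup g b"
proof -
  have iff: "a' + shift m b' = a + shift m b \<longleftrightarrow> a' = a \<and> b' = b" if "a' \<in> keys f" for a' b'
  proof
    assume eq: "a' + shift m b' = a + shift m b"
    have "a' = a"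
    proof (rule poly_mapping_eqI)
      fix i
      show "lookup a' i = lookup a i"
      proof (cases "i < m")
        case True
        then show ?thesis using arg_cong[OF eq, of "\<lambda>c. lookup c i"] by (simp add: lookup_add lookup_shift)
      next
        case False
        then have "i \<notin> keys a'" "i \<notin> keys a" using f[OF that] a by auto
        then show ?thesis by (simp add: in_keys_iff)
      qed
    qed
    with eq show "a' = a \<and> b' = b" using inj_shift by (auto dest: injD)
  qed simp
  have "f * push_keys (shift m) g =
    (\<Sum>a'\<in>keys f. \<Sum>b'\<in>keys g. Poly_Mapping.single (a' + shift m b') (lookup f a' * lookup g b'))"
    by (subst sum_monomials[of f, symmetric]) (simp add: push_keys_def sum_product mult_single)
  then have "lookup (f * push_keys (shift m) g) (a + shift m b) =
    (\<Sum>a'\<in>keys f. \<Sum>b'\<in>keys g. if a' = a \<and> b' = b then lookup f a' * lookup g b' else 0)"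
    by (simp add: lookup_sum lookup_single when_def iff)
  also have "\<dots> = (\<Sum>a'\<in>keys f. if a' = a then \<Sum>b'\<in>keys g. if b' = b then lookup f a' * lookup g b' else 0 else 0)"
    by (intro sum.cong refl) (auto intro: sum.neutral)
  also have "\<dots> = lookup f a * lookup g b"
    by (simp add: in_keys_iff)
  finally show ?thesis .
qed

section \<open>Concatenating two sequences of rectangles\<close>

text \<open>
  A cut inside one of the two parts yields the roots of this part, and otherwise only pairs with
  one index in each block. All these cross pairs are separated by the cut between the two parts,
  which is an admissible cut unless the first block is empty.
\<close>

lemma Phi_append:
  "Phi (\<eta>1 @ \<eta>2) = Phi \<eta>1 \<union> (\<lambda>(i, j). (i + sum_list \<eta>1, j + sum_list \<eta>1)) ` Phi \<eta>2
     \<union> {..<sum_list \<eta>1} \<times> {sum_list \<eta>1..<sum_list \<eta>1 + sum_list \<eta>2}" (is "?L = ?A \<union> ?B \<union> ?C")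
proof (intro set_eqI iffI)
  let ?m = "sum_list \<eta>1"
  fix p assume "p \<in> ?L"
  then obtain i j u where p: "p = (i, j)" and u: "u \<in> {1..length \<eta>1 + length \<eta>2}"
    "i < sum_list (take u (\<eta>1 @ \<eta>2))" "sum_list (take u (\<eta>1 @ \<eta>2)) \<le> j" "j < ?m + sum_list \<eta>2"
    by (auto simp: Phi_def)
  have take_le: "sum_list (take v \<eta>1) \<le> ?m" for v
    by (metis append_take_drop_id le_add1 sum_list_append)
  show "p \<in> ?A \<union> ?B \<union> ?C"
  proof (cases "u \<le> length \<eta>1")
    case True
    then show ?thesis using u p take_le[of u] by (auto simp: Phi_def)
  next
    case False
    then have iv: "i < ?m + sum_list (take (u - length \<eta>1) \<eta>2)" "?m + sum_list (take (u - length \<eta>1) \<eta>2) \<le> j"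
      using u by auto
    show ?thesis
    proof (cases "i < ?m")
      case True
      then show ?thesis using iv u p by auto
    next
      case i: False
      have "(i - ?m, j - ?m) \<in> Phi \<eta>2"
        unfolding Phi_def using i iv u False by (auto intro!: bexI[of _ "u - length \<eta>1"])
      then have "p \<in> ?B" using i iv p by (force simp: image_iff)
      then show ?thesis by blast
    qed
  qed
next
  let ?m = "sum_list \<eta>1"
  fix p assume "p \<in> ?A \<union> ?B \<union> ?C"
  then consider "p \<in> ?A" | "p \<in> ?B" | "p \<in> ?C" by blast
  then show "p \<in> ?L"
  proof cases
    case 1
    then obtain i j u where "p = (i, j)" "u \<in> {1..length \<eta>1}" "i < sum_list (take u \<eta>1)"
      "sum_list (take u \<eta>1) \<le> j" "j < ?m" by (auto simp: Phi_def)
    then show ?thesis by (auto simp: Phi_def intro!: bexI[of _ u])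
  next
    case 2
    then obtain i j u where "p = (i + ?m, j + ?m)" "u \<in> {1..length \<eta>2}" "i < sum_list (take u \<eta>2)"
      "sum_list (take u \<eta>2) \<le> j" "j < sum_list \<eta>2" by (auto simp: Phi_def)
    then show ?thesis by (auto simp: Phi_def intro!: bexI[of _ "length \<eta>1 + u"])
  next
    case 3
    then show ?thesis by (cases \<eta>1) (auto simp: Phi_def intro!: bexI[of _ "length \<eta>1"])
  qed
qed

lemma kostka_generating_append:
  assumes "length \<mu>1 = sum_list \<eta>1"
  defines "m \<equiv> sum_list \<eta>1"
  shows "kostka_generating (map ((+) N) \<mu>1 @ \<mu>2) (\<eta>1 @ \<eta>2) =
    fps_const (Poly_Mapping.single (vec (replicate m (int N))) 1) * kostka_generating \<mu>1 \<eta>1 *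
    shift_fps m (kostka_generating \<mu>2 \<eta>2) *
    (\<Prod>(i, j)\<in>{..<m} \<times> {m..<m + sum_list \<eta>2}. geometric (var_ratio i j))"
proof -
  let ?g = "\<lambda>(i, j). geometric (var_ratio i j)"
  let ?s = "\<lambda>(i, j). (i + m, j + m)"
  have "?s ` Phi \<eta>2 \<inter> (Phi \<eta>1 \<union> {..<m} \<times> {m..<m + sum_list \<eta>2}) = {}"
    "Phi \<eta>1 \<inter> {..<m} \<times> {m..<m + sum_list \<eta>2} = {}"
    using Phi_less[of _ _ \<eta>1] by (fastforce simp: m_def)+
  then have "(\<Prod>p\<in>Phi (\<eta>1 @ \<eta>2). ?g p) = (\<Prod>p\<in>Phi \<eta>1. ?g p) * (\<Prod>p\<in>?s ` Phi \<eta>2. ?g p) *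
      (\<Prod>p\<in>{..<m} \<times> {m..<m + sum_list \<eta>2}. ?g p)"
    unfolding Phi_append m_def[symmetric]
    by (subst prod.union_disjoint prod.union_disjoint, (auto simp: finite_Phi)[3])+ simp
  also have "(\<Prod>p\<in>?s ` Phi \<eta>2. ?g p) = (\<Prod>(i, j)\<in>Phi \<eta>2. geometric (var_ratio (i + m) (j + m)))"
    by (subst prod.reindex) (auto simp: inj_on_def case_prod_unfold)
  finally have prod: "(\<Prod>p\<in>Phi (\<eta>1 @ \<eta>2). ?g p) = (\<Prod>p\<in>Phi \<eta>1. ?g p) *
      shift_fps m (\<Prod>p\<in>Phi \<eta>2. ?g p) * (\<Prod>p\<in>{..<m} \<times> {m..<m + sum_list \<eta>2}. ?g p)"
    by (simp add: shift_fps_prod_geometric)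
  have "vec (map int (map ((+) N) \<mu>1)) = vec (replicate m (int N)) + vec (map int \<mu>1)"
    using assms by (intro poly_mapping_eqI) (auto simp: lookup_add lookup_vec)
  then have "xpow (map int (map ((+) N) \<mu>1 @ \<mu>2)) = Poly_Mapping.single (vec (replicate m (int N))) 1 *
      xpow (map int \<mu>1) * Poly_Mapping.single (shift m (vec (map int \<mu>2))) 1"
    using assms by (simp add: xpow_def vec_append mult_single)
  then show ?thesis
    unfolding kostka_generating_def prod shift_fps_mult shift_fps_const_xpow
    by (simp add: mult_ac flip: fps_const_mult)
qed

text \<open>
  If each step in \<open>q\<close> of a factor \<open>X\<close> raises the degree in the first \<open>m\<close> variables, then exponents of
  minimal degree see only its constant term. This removes the cross roots.
\<close>

lemma lookup_mult_minimal_degree: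
  fixes A X :: "laurent fps"
  assumes A: "weights_in (\<lambda>_. {a. degree_upto m a = D}) A"
    and X: "weights_in (\<lambda>d. {a. degree_upto m a = int d}) X" "X $ 0 = 1"
    and c: "degree_upto m c \<le> D"
  shows "lookup ((A * X) $ d) c = lookup (A $ d) c"
proof -
  have "lookup (A $ i * X $ (d - i)) c = 0" if "i < d" for i
  proof (rule ccontr)
    assume "lookup (A $ i * X $ (d - i)) c \<noteq> 0"
    then obtain a b where ab: "c = a + b" "a \<in> keys (A $ i)" "b \<in> keys (X $ (d - i))"
      using keys_mult[of "A $ i" "X $ (d - i)"] by (auto simp: in_keys_iff)
    then have "degree_upto m a = D" "degree_upto m b = int (d - i)"
      using A X by (auto simp: weights_in_def)
    with ab c that show False by simp
  qed
  then have "lookup ((A * X) $ d) c = (\<Sum>i=0..d. if i = d then lookup (A $ d) c else 0)"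
    unfolding fps_mult_nth lookup_sum using X(2) by (intro sum.cong) auto
  then show ?thesis by simp
qed

text \<open>
  The first \<open>m\<close> entries of a strictly decreasing sequence have the largest sum among all choices of
  \<open>m\<close> entries, and they are the only choice with this sum: exchanging an entry from the beginning
  for one from position \<open>m\<close> onwards loses something. This removes the permutations that mix the
  two blocks.
\<close>

lemma degree_upto_act:
  assumes w: "w permutes {..<n}" and m: "m \<le> n"
    and dec: "\<And>i j. i < j \<Longrightarrow> j < n \<Longrightarrow> lookup b i > lookup b j"
  shows "degree_upto m (act w b) \<le> degree_upto m b"
    and "w ` {..<m} \<noteq> {..<m} \<Longrightarrow> degree_upto m (act w b) < degree_upto m b"
proof -
  let ?S = "w ` {..<m}" and ?T = "{..<m}" and ?f = "lookup b"
  have inj: "inj_on w {..<m}" using permutes_inj_on[OF w] .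
  have S: "?S \<subseteq> {..<n}" using m permutes_image[OF w] by (metis image_mono lessThan_subset_iff)
  have "degree_upto m (act w b) = sum ?f ?S"
    using inj by (simp add: degree_upto_def lookup_act[OF w] sum.reindex)
  also have "\<dots> = sum ?f (?S - ?T) + sum ?f (?S \<inter> ?T)"
    by (metis Diff_Diff_Int Diff_subset add.commute finite_imageI finite_lessThan sum.subset_diff inf.commute inf_commute)
  finally have 1: "degree_upto m (act w b) = sum ?f (?S - ?T) + sum ?f (?S \<inter> ?T)" .
  have 2: "degree_upto m b = sum ?f (?T - ?S) + sum ?f (?S \<inter> ?T)"
    unfolding degree_upto_def by (metis Int_commute finite_lessThan sum.Int_Diff add.commute)
  have card: "card (?S - ?T) = card (?T - ?S)"
    using card_image[OF inj] by (simp add: card_Diff_subset_Int Int_commute)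
  show lt: "degree_upto m (act w b) < degree_upto m b" if "?S \<noteq> ?T"
  proof -
    have ne: "?S - ?T \<noteq> {}" "?T - ?S \<noteq> {}"
      using that card card_image[OF inj] by (metis card_subset_eq card.empty card_0_eq Diff_eq_empty_iff finite_Diff finite_imageI finite_lessThan)+
    then have mn: "m < n" using S by auto
    have "sum ?f (?S - ?T) \<le> of_nat (card (?S - ?T)) * ?f m"
    proof (rule sum_bounded_above)
      fix i assume "i \<in> ?S - ?T"
      then have "m \<le> i" "i < n" using S by auto
      then show "?f i \<le> ?f m" using dec[of m i] by (cases "i = m") auto
    qed
    also have "\<dots> = (\<Sum>i\<in>?T - ?S. ?f m)"
      by (simp add: card)
    also have "\<dots> < sum ?f (?T - ?S)"
      using dec mn ne(2) by (intro sum_strict_mono) auto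
    finally show ?thesis using 1 2 by simp
  qed
  show "degree_upto m (act w b) \<le> degree_upto m b"
    using lt 1 2 by (cases "?S = ?T") auto
qed

definition block_perm :: "nat \<Rightarrow> (nat \<Rightarrow> nat) \<Rightarrow> (nat \<Rightarrow> nat) \<Rightarrow> nat \<Rightarrow> nat"
  where "block_perm m v w i = (if i < m then v i else w (i - m) + m)"

text \<open>
  A block permutation is the product of \<open>v\<close> and of the translate of \<open>w\<close>, and the sign is multiplicative
  and does not change under translation.
\<close>

lemma block_perm:
  assumes v: "v permutes {..<m}" and w: "w permutes {..<k}"
  shows "block_perm m v w permutes {..<m + k}"
    and "block_perm m v w ` {..<m} = {..<m}"
    and "sign (block_perm m v w) = sign v * sign w"
proof -
  let ?w = "map_permutation {..<k} (\<lambda>i. i + m) w"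
  have inj: "inj_on (\<lambda>i. i + m) {..<k}" by simp
  have "bij_betw (\<lambda>i. i + m) {..<k} {m..<m + k}"
    by (rule bij_betwI[of _ _ _ "\<lambda>i. i - m"]) auto
  then have w': "?w permutes {m..<m + k}" by (rule map_permutation_permutes[OF _ w])
  have eq: "block_perm m v w = v \<circ> ?w"
  proof
    fix i
    consider "i < m" | j where "i = j + m" "j < k" | "m + k \<le> i"
      by (metis add.commute add_less_cancel_left le_Suc_ex linorder_not_less)
    then show "block_perm m v w i = (v \<circ> ?w) i"
    proof cases
      case 1
      then show ?thesis using permutes_not_in[OF w', of i] by (simp add: block_perm_def)
    next
      case 2
      then show ?thesis
        using map_permutation_apply[OF inj, of j w] permutes_not_in[OF v, of "w j + m"]
        by (simp add: block_perm_def)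
    next
      case 3
      then show ?thesis
        using permutes_not_in[OF w', of i] permutes_not_in[OF v, of i] permutes_not_in[OF w, of "i - m"]
        by (simp add: block_perm_def)
    qed
  qed
  show "block_perm m v w permutes {..<m + k}"
    unfolding eq by (intro permutes_compose permutes_subset[OF v] permutes_subset[OF w']) auto
  show "block_perm m v w ` {..<m} = {..<m}"
    using permutes_image[OF v] by (simp add: block_perm_def cong: image_cong_simp)
  show "sign (block_perm m v w) = sign v * sign w"
    unfolding eq using v w' w
    by (subst sign_compose) (auto simp: sign_map_permutation intro: permutes_imp_permutation[rotated])
qed

lemma sum_block_perms:
  "(\<Sum>u | u permutes {..<m + k} \<and> u ` {..<m} = {..<m}. f u) =
   (\<Sum>v | v permutes {..<m}. \<Sum>w | w permutes {..<k}. f (block_perm m v w))"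
proof -
  let ?P = "\<lambda>n. {w. w permutes {..<n::nat}}"
  let ?B = "{u. u permutes {..<m + k} \<and> u ` {..<m} = {..<m}}"
  have "(\<Sum>u\<in>?B. f u) = (\<Sum>(v, w)\<in>?P m \<times> ?P k. f (block_perm m v w))"
  proof (rule sum.reindex_bij_witness[where i = "\<lambda>(v, w). block_perm m v w"
        and j = "\<lambda>u. (\<lambda>i. if i < m then u i else i, \<lambda>i. u (i + m) - m)"])
    fix u assume "u \<in> ?B"
    then have u: "u permutes {..<m + k}" and um: "u ` {..<m} = {..<m}" by auto
    have inj: "inj u" by (rule permutes_inj[OF u])
    have ge: "u i \<ge> m" if "i \<ge> m" for i
    proof (rule ccontr)
      assume "\<not> m \<le> u i"
      then have "u i \<in> u ` {..<m}" unfolding um by simp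
      with that show False by (simp add: inj_image_mem_iff[OF inj])
    qed
    show "(case (\<lambda>i. if i < m then u i else i, \<lambda>i. u (i + m) - m) of (v, w) \<Rightarrow> block_perm m v w) = u"
      using ge by (auto simp: block_perm_def fun_eq_iff)
    have "bij_betw u {..<m} {..<m}"
      using um permutes_inj_on[OF u] by (simp add: bij_betw_def)
    then have "bij_betw (\<lambda>i. if i < m then u i else i) {..<m} {..<m}"
      by (rule bij_betw_cong[THEN iffD1, rotated]) simp
    then have 1: "(\<lambda>i. if i < m then u i else i) permutes {..<m}"
      by (rule bij_imp_permutes) auto
    let ?w = "\<lambda>i. u (i + m) - m"
    have "inj ?w"
    proof (rule injI)
      fix i j assume "?w i = ?w j"
      then have "u (i + m) = u (j + m)" using ge[of "i + m"] ge[of "j + m"] by linarith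
      then show "i = j" using inj_eq[OF inj] by simp
    qed
    moreover have "?w ` {..<k} \<subseteq> {..<k}"
    proof clarify
      fix i assume "i < k"
      then have "u (i + m) < m + k" using permutes_in_image[OF u, of "i + m"] by simp
      then show "u (i + m) - m < k" using ge[of "i + m"] by auto
    qed
    ultimately have "bij_betw ?w {..<k} {..<k}"
      by (metis bij_betw_def endo_inj_surj finite_lessThan inj_on_subset subset_UNIV)
    then have 2: "?w permutes {..<k}"
      using permutes_not_in[OF u] by (intro bij_imp_permutes) auto
    show "(\<lambda>i. if i < m then u i else i, ?w) \<in> ?P m \<times> ?P k" using 1 2 by simp
    show "(case (\<lambda>i. if i < m then u i else i, ?w) of (v, w) \<Rightarrow> f (block_perm m v w)) = f u"
      using ge by (auto simp: block_perm_def fun_eq_iff intro!: arg_cong[of _ _ f])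
  next
    fix p assume "p \<in> ?P m \<times> ?P k"
    then obtain v w where p: "p = (v, w)" "v permutes {..<m}" "w permutes {..<k}" by auto
    show "(case p of (v, w) \<Rightarrow> block_perm m v w) \<in> ?B"
      using block_perm[OF p(2,3)] p(1) by simp
    show "(\<lambda>i. if i < m then (case p of (v, w) \<Rightarrow> block_perm m v w) i else i,
           \<lambda>i. (case p of (v, w) \<Rightarrow> block_perm m v w) (i + m) - m) = p"
      using permutes_not_in[OF p(2)] p(1) by (auto simp: block_perm_def fun_eq_iff)
  qed
  then show ?thesis by (simp add: sum.cartesian_product)
qed

text \<open>
  Total degree is invariant under permutations of the variables and under multiplication by roots,
  so the partitions that occur have the size of \<open>\<mu>\<close>.
\<close>

lemma parabolic_kostka_eq_0:
  assumes \<mu>: "length \<mu> = sum_list \<eta>"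
    and L: "L \<notin> dominant_weights (sum_list \<eta>) \<or> sum_list L \<noteq> int (sum_list \<mu>)"
  shows "parabolic_kostka \<mu> \<eta> L = 0"
proof (cases "L \<in> dominant_weights (sum_list \<eta>)")
  case False
  then show ?thesis
    using is_kostka_family_parabolic_kostka[OF \<mu>] by (simp add: is_kostka_family_def Let_def)
next
  case True
  let ?n = "sum_list \<eta>"
  have "degree_upto ?n (vec L) = sum_list L"
    using True by (simp add: degree_upto_def lookup_vec sum_list_sum_nth atLeast0LessThan dominant_weights_def)
  with True L have deg: "degree_upto ?n (vec L) \<noteq> int (sum_list \<mu>)" by simp
  have "parabolic_kostka \<mu> \<eta> L $ d = 0" for d
    unfolding parabolic_kostka_nth[OF \<mu> True] lookup_antisymmetrize
  proof (intro sum.neutral ballI)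
    fix w assume "w \<in> {w. w permutes {..<?n}}"
    then have w: "w permutes {..<?n}" by simp
    have "degree_upto ?n (act w b) = degree_upto ?n b" for b
      unfolding degree_upto_def lookup_act[OF w] by (rule sum.permute[OF w, symmetric, unfolded o_def])
    then have "degree_upto ?n (act w (shifted_weight ?n L) - vec (delta ?n)) \<noteq> int (sum_list \<mu>)"
      using deg by simp
    then have "act w (shifted_weight ?n L) - vec (delta ?n) \<notin> keys (kostka_generating \<mu> \<eta> $ d)"
      using weights_in_kostka_generating[OF \<mu>] unfolding weights_in_def by blast
    then show "sign w * lookup (kostka_generating \<mu> \<eta> $ d) (act w (shifted_weight ?n L) - vec (delta ?n)) = 0"
      by (simp add: in_keys_iff)
  qed
  then show ?thesis by (simp add: fps_eq_iff)
qed

text \<open>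
  The coefficient of \<open>\<lambda> = (L1 + N, L2)\<close> is an alternating sum, over permutations \<open>u\<close>, of the coefficients
  of the generating function at \<open>u(\<lambda> + \<delta>) - \<delta>\<close>. In the first \<open>m\<close> variables, the generating function lives
  in degrees at least \<open>D = |\<mu>1| + m N\<close>, and these exponents in degrees at most \<open>|L1| + m N\<close>. As both bounds
  agree, only the extreme terms on both sides meet: those without cross roots, and the \<open>u\<close> that
  preserve the blocks. What is left is a product over the two blocks.
\<close>

lemma parabolic_kostka_append:
  assumes \<mu>1: "length \<mu>1 = sum_list \<eta>1" and \<mu>2: "length \<mu>2 = sum_list \<eta>2"
    and L1: "L1 \<in> dominant_weights (sum_list \<eta>1)" and L2: "L2 \<in> dominant_weights (sum_list \<eta>2)"
    and L: "map ((+) (int N)) L1 @ L2 \<in> dominant_weights (sum_list (\<eta>1 @ \<eta>2))"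
    and size: "sum_list L1 = int (sum_list \<mu>1)"
  shows "parabolic_kostka (map ((+) N) \<mu>1 @ \<mu>2) (\<eta>1 @ \<eta>2) (map ((+) (int N)) L1 @ L2) =
    parabolic_kostka \<mu>1 \<eta>1 L1 * parabolic_kostka \<mu>2 \<eta>2 L2"
proof (rule fps_ext)
  fix d
  define m k where "m = sum_list \<eta>1" and "k = sum_list \<eta>2"
  define b where "b = shifted_weight (m + k) (map ((+) (int N)) L1 @ L2)"
  define G1 G2 where "G1 = kostka_generating \<mu>1 \<eta>1" and "G2 = kostka_generating \<mu>2 \<eta>2"
  define t where "t = vec (replicate m (int N))"
  define A where "A = fps_const (Poly_Mapping.single t 1) * G1 * shift_fps m G2"
  define X where "X = (\<Prod>(i, j)\<in>{..<m} \<times> {m..<m + k}. geometric (var_ratio i j))"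
  define D where "D = int (sum_list \<mu>1) + int m * int N"
  define c1 where "c1 v = act v (shifted_weight m L1) - vec (delta m)" for v
  define c2 where "c2 w = act w (shifted_weight k L2) - vec (delta k)" for w
  let ?P = "\<lambda>n. {w. w permutes {..<n::nat}}"
  have len: "length L1 = m" "length L2 = k"
    using L1 L2 by (auto simp: dominant_weights_def m_def k_def)
  have G1: "weights_in (\<lambda>_. {a. keys a \<subseteq> {..<m} \<and> degree_upto m a = int (sum_list \<mu>1)}) G1"
    unfolding G1_def m_def by (rule weights_in_kostka_generating[OF \<mu>1])
  have "degree_upto m t = int m * int N"
    by (simp add: t_def degree_upto_def lookup_vec)
  then have "weights_in (\<lambda>_. {a. degree_upto m a = int m * int N}) (fps_const (Poly_Mapping.single t 1))"
    by (auto simp: weights_in_def)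
  then have "weights_in (\<lambda>_. {a. degree_upto m a = D}) (fps_const (Poly_Mapping.single t 1) * G1)"
    by (rule weights_in_mult[OF _ G1]) (auto simp: D_def)
  moreover have "weights_in (\<lambda>_. {a. degree_upto m a = 0}) (shift_fps m G2)"
  proof -
    have "degree_upto m (shift m a) = 0" for a by (simp add: degree_upto_def lookup_shift)
    moreover have "a \<in> range (shift m)" if "a \<in> keys (push_keys (shift m) g)" for a g
      using that lookup_push_keys_outside by (metis in_keys_iff)
    ultimately show ?thesis by (force simp: weights_in_def shift_fps_def)
  qed
  ultimately have A: "weights_in (\<lambda>_. {a. degree_upto m a = D}) A"
    unfolding A_def by (rule weights_in_mult) auto
  have X: "weights_in (\<lambda>d. {a. degree_upto m a = int d}) X"
    unfolding X_def by (rule weights_in_prod_geometric) (auto simp: graded_monoid_def)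
  have X0: "X $ 0 = 1"
  proof -
    have "(\<Prod>(i, j)\<in>P. geometric (var_ratio i j)) $ 0 = 1" for P
      by (induction P rule: infinite_finite_induct) (auto simp: geometric_def)
    then show ?thesis by (simp add: X_def)
  qed
  have gen: "kostka_generating (map ((+) N) \<mu>1 @ \<mu>2) (\<eta>1 @ \<eta>2) = A * X"
    unfolding A_def X_def t_def G1_def G2_def m_def k_def by (rule kostka_generating_append[OF \<mu>1])
  \<comment> \<open>In the first block, the sequences delta for \<open>m + k\<close> and for \<open>m\<close> variables differ by the constant
    vector \<open>k\<close>. It is invariant under permutations of the block and cancels in \<open>u(\<lambda> + \<delta>) - \<delta>\<close>.\<close>
  have b: "b = shifted_weight m L1 + t + vec (replicate m (int k)) + shift m (shifted_weight k L2)"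
    unfolding b_def t_def using len
    by (intro poly_mapping_eqI) (auto simp: lookup_add lookup_shift lookup_vec nth_append)
  have \<delta>: "vec (delta (m + k)) = vec (delta m) + vec (replicate m (int k)) + shift m (vec (delta k))"
    by (intro poly_mapping_eqI) (auto simp: lookup_add lookup_shift lookup_vec)
  have dec: "lookup b i > lookup b j" if "i < j" "j < m + k" for i j
    unfolding b_def using shifted_weight_strict[OF L] that by (simp add: m_def k_def)
  have deg_b: "degree_upto m b = D + degree_upto m (vec (delta (m + k)))"
    using len size \<open>degree_upto m t = _\<close> unfolding b \<delta>
    by (simp add: D_def) (simp add: degree_upto_def lookup_vec lookup_shift sum_list_sum_nth atLeast0LessThan)
  have block: "lookup (A $ d) (act (block_perm m v w) b - vec (delta (m + k))) =
      (\<Sum>i=0..d. lookup (G1 $ i) (c1 v) * lookup (G2 $ (d - i)) (c2 w))"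
    if v: "v permutes {..<m}" and w: "w permutes {..<k}" for v w
  proof -
    have "act (block_perm m v w) b = act v (shifted_weight m L1) + t + vec (replicate m (int k)) +
        shift m (act w (shifted_weight k L2))"
    proof (rule poly_mapping_eqI)
      fix i
      have "v i < m \<longleftrightarrow> i < m" for i using permutes_in_image[OF v, of i] by simp
      moreover have "v i = i" if "\<not> i < m" for i using permutes_not_in[OF v] that by simp
      ultimately show "lookup (act (block_perm m v w) b) i = lookup (act v (shifted_weight m L1) + t +
          vec (replicate m (int k)) + shift m (act w (shifted_weight k L2))) i"
        unfolding b t_def using len
        by (auto simp: lookup_act[OF block_perm(1)[OF v w]] lookup_act[OF v] lookup_act[OF w]
            lookup_add lookup_shift lookup_vec block_perm_def)
    qed
    then have eq: "act (block_perm m v w) b - vec (delta (m + k)) = t + (c1 v + shift m (c2 w))"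
      unfolding \<delta> c1_def c2_def shift_simps by (simp only: algebra_simps)
    have "keys (shifted_weight m L1) \<subseteq> {..<m}"
      using keys_add[of "vec L1" "vec (delta m)"] keys_vec[of L1] keys_delta[of m] len by auto
    then have "keys (c1 v) \<subseteq> {..<m}"
      using keys_diff[of "act v (shifted_weight m L1)" "vec (delta m)"] keys_delta[of m] keys_act[OF v]
      unfolding c1_def by blast
    then have "lookup (G1 $ i * push_keys (shift m) (G2 $ j)) (c1 v + shift m (c2 w)) =
        lookup (G1 $ i) (c1 v) * lookup (G2 $ j) (c2 w)" for i j
      using G1 by (intro lookup_mult_shift) (auto simp: weights_in_def)
    moreover have "A $ d = Poly_Mapping.single t 1 * (\<Sum>i=0..d. G1 $ i * push_keys (shift m) (G2 $ (d - i)))"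
      by (simp add: A_def mult.assoc) (simp add: fps_mult_nth shift_fps_def)
    ultimately show ?thesis
      unfolding eq by (simp add: lookup_single_one_mult lookup_sum)
  qed
  have "parabolic_kostka (map ((+) N) \<mu>1 @ \<mu>2) (\<eta>1 @ \<eta>2) (map ((+) (int N)) L1 @ L2) $ d =
      (\<Sum>u\<in>?P (m + k). sign u * lookup ((A * X) $ d) (act u b - vec (delta (m + k))))"
    using parabolic_kostka_nth[OF _ L, of "map ((+) N) \<mu>1 @ \<mu>2" d] \<mu>1 \<mu>2
    by (simp add: gen lookup_antisymmetrize b_def m_def k_def)
  also have "\<dots> = (\<Sum>u\<in>?P (m + k). sign u * lookup (A $ d) (act u b - vec (delta (m + k))))"
  proof (intro sum.cong refl arg_cong2[of _ _ _ _ "(*)"] lookup_mult_minimal_degree[OF A X X0])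
    fix u assume "u \<in> ?P (m + k)"
    then show "degree_upto m (act u b - vec (delta (m + k))) \<le> D"
      using degree_upto_act(1)[where n = "m + k" and m = m and b = b and w = u, OF _ le_add1 dec] deg_b by simp
  qed
  also have "\<dots> = (\<Sum>u | u permutes {..<m + k} \<and> u ` {..<m} = {..<m}.
      sign u * lookup (A $ d) (act u b - vec (delta (m + k))))"
  proof (rule sum.mono_neutral_right)
    show "\<forall>u\<in>?P (m + k) - {u. u permutes {..<m + k} \<and> u ` {..<m} = {..<m}}.
        sign u * lookup (A $ d) (act u b - vec (delta (m + k))) = 0"
    proof
      fix u assume "u \<in> ?P (m + k) - {u. u permutes {..<m + k} \<and> u ` {..<m} = {..<m}}"
      then have "degree_upto m (act u b - vec (delta (m + k))) < D"
        using degree_upto_act(2)[where n = "m + k" and m = m and b = b and w = u, OF _ le_add1 dec] deg_b by simp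
      then have "act u b - vec (delta (m + k)) \<notin> keys (A $ d)"
        using A unfolding weights_in_def by blast
      then show "sign u * lookup (A $ d) (act u b - vec (delta (m + k))) = 0"
        by (simp add: in_keys_iff)
    qed
  qed (auto simp: finite_permutations)
  also have "\<dots> = (\<Sum>v\<in>?P m. \<Sum>w\<in>?P k. \<Sum>i=0..d.
      (sign v * lookup (G1 $ i) (c1 v)) * (sign w * lookup (G2 $ (d - i)) (c2 w)))"
    unfolding sum_block_perms
    by (intro sum.cong refl) (simp add: block block_perm(3) sum_distrib_left mult_ac)
  also have "\<dots> = (\<Sum>v\<in>?P m. \<Sum>i=0..d. \<Sum>w\<in>?P k.
      (sign v * lookup (G1 $ i) (c1 v)) * (sign w * lookup (G2 $ (d - i)) (c2 w)))"
    by (intro sum.cong refl sum.swap)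
  also have "\<dots> = (\<Sum>i=0..d. \<Sum>v\<in>?P m. \<Sum>w\<in>?P k.
      (sign v * lookup (G1 $ i) (c1 v)) * (sign w * lookup (G2 $ (d - i)) (c2 w)))"
    by (rule sum.swap)
  also have "\<dots> = (parabolic_kostka \<mu>1 \<eta>1 L1 * parabolic_kostka \<mu>2 \<eta>2 L2) $ d"
    unfolding fps_mult_nth parabolic_kostka_nth[OF \<mu>1 L1] parabolic_kostka_nth[OF \<mu>2 L2]
      lookup_antisymmetrize G1_def G2_def m_def k_def c1_def c2_def
    by (simp add: sum_product)
  finally show "parabolic_kostka (map ((+) N) \<mu>1 @ \<mu>2) (\<eta>1 @ \<eta>2) (map ((+) (int N)) L1 @ L2) $ d =
    (parabolic_kostka \<mu>1 \<eta>1 L1 * parabolic_kostka \<mu>2 \<eta>2 L2) $ d" .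
qed

section \<open>The semigroup property\<close>

definition pad :: "nat \<Rightarrow> nat list \<Rightarrow> int list"
  where "pad n lam = map int lam @ replicate (n - length lam) 0"

text \<open>
  A nonzero value excludes the default value 0 for partitions that are too long and forces the
  partition and the rectangles to have the same size, which the product formula relies on.
\<close>

lemma rect_kostka_nonzeroD:
  assumes nz: "rect_kostka lam R \<noteq> 0"
  defines "n \<equiv> sum_list (map length R)"
  shows "length lam \<le> n" "rect_kostka lam R = parabolic_kostka (concat R) (map length R) (pad n lam)"
    "pad n lam \<in> dominant_weights n" "sum_list (pad n lam) = int (sum_list (concat R))"
proof -
  show le: "length lam \<le> n"
    and eq: "rect_kostka lam R = parabolic_kostka (concat R) (map length R) (pad n lam)"
    using nz by (auto simp: rect_kostka_def Let_def pad_def n_def split: if_splits)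
  have "length (concat R) = sum_list (map length R)" by (rule length_concat)
  from parabolic_kostka_eq_0[OF this, of "pad n lam"] eq nz
  show "pad n lam \<in> dominant_weights n" "sum_list (pad n lam) = int (sum_list (concat R))"
    by (auto simp: n_def)
qed

text \<open>
  Widening the rectangles of \<open>R1\<close> and the rows of \<open>lam1\<close>, empty rows included, by a large \<open>N\<close> makes both
  concatenations weakly decreasing.
\<close>

lemma rect_kostka_mult:
  assumes lam: "is_partition lam1" "is_partition lam2"
    and R: "dominant_rectangles R1" "dominant_rectangles R2"
    and nz: "rect_kostka lam1 R1 \<noteq> 0" "rect_kostka lam2 R2 \<noteq> 0"
  obtains lam R where "is_partition lam" "dominant_rectangles R"
    "rect_kostka lam R = rect_kostka lam1 R1 * rect_kostka lam2 R2"
proof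
  define m k where "m = sum_list (map length R1)" and "k = sum_list (map length R2)"
  note 1 = rect_kostka_nonzeroD[OF nz(1), folded m_def]
  note 2 = rect_kostka_nonzeroD[OF nz(2), folded k_def]
  \<comment> \<open>A bound for all parts of \<open>lam2\<close> and all row lengths of \<open>R2\<close>; it is positive so that the
    padding zeros of \<open>lam1\<close> become parts.\<close>
  define N where "N = Suc (sum_list lam2 + sum_list (concat R2))"
  define lam where "lam = map ((+) N) (lam1 @ replicate (m - length lam1) 0) @ lam2"
  define R where "R = map (map ((+) N)) R1 @ R2"
  have N_lam: "x < N" if "x \<in> set lam2" for x
    using member_le_sum_list[OF that] by (simp add: N_def)
  have N_R: "x < N" if "r \<in> set R2" "x \<in> set r" for r x
  proof -
    have "x \<le> sum_list (concat R2)" using that by (intro member_le_sum_list) auto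
    then show ?thesis by (simp add: N_def)
  qed
  have "0 < N" by (simp add: N_def)
  have len: "length lam = m + length lam2" using 1(1) by (simp add: lam_def)
  show part: "is_partition lam"
    using lam N_lam \<open>0 < N\<close> by (auto simp: lam_def is_partition_def sorted_wrt_append sorted_wrt_map
        sorted_wrt_iff_nth_less[of _ "replicate _ _"] intro: less_imp_le trans_le_add1)
  show "dominant_rectangles R"
  proof -
    have ne: "r \<noteq> []" if "r \<in> set R1 \<union> set R2" for r
      using that R by (auto simp: dominant_rectangles_def rectangular_def)
    have hd1: "hd (map ((+) N) r) = N + hd r" if "r \<in> set R1" for r
      using that ne[of r] by (simp add: hd_map)
    have hd2: "hd r < N" if "r \<in> set R2" for r
      using that ne[of r] by (intro N_R[of r]) auto
    have rect: "rectangular (map ((+) N) r)" if "rectangular r" for r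
    proof -
      from that obtain h x where "h > 0" "x > 0" "r = replicate h x"
        unfolding rectangular_def by blast
      then have "map ((+) N) r = replicate h (N + x)" "N + x > 0" by auto
      with \<open>h > 0\<close> show ?thesis unfolding rectangular_def by blast
    qed
    have "map hd R = map ((+) N) (map hd R1) @ map hd R2"
      using hd1 by (simp add: R_def)
    then have "sorted_wrt (\<ge>) (map hd R)"
      using R hd2 by (auto simp: dominant_rectangles_def sorted_wrt_append sorted_wrt_map
          less_imp_le trans_le_add1)
    with rect show ?thesis using R by (auto simp: dominant_rectangles_def R_def)
  qed
  have pad: "pad (m + k) lam = map ((+) (int N)) (pad m lam1) @ pad k lam2"
    using len by (simp add: pad_def lam_def)
  have dom: "pad (m + k) lam \<in> dominant_weights (m + k)"
    using part len 2(1) by (auto simp: dominant_weights_def pad_def is_partition_def sorted_wrt_append sorted_wrt_map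
        sorted_wrt_iff_nth_less[of _ "replicate _ _"])
  have R': "concat R = map ((+) N) (concat R1) @ concat R2" "map length R = map length R1 @ map length R2"
    by (simp_all add: R_def map_concat o_def)
  have "rect_kostka lam R = parabolic_kostka (concat R) (map length R) (pad (m + k) lam)"
    using len 2(1) by (simp add: rect_kostka_def Let_def pad_def m_def k_def R'(2))
  also have "\<dots> = parabolic_kostka (concat R1) (map length R1) (pad m lam1) *
      parabolic_kostka (concat R2) (map length R2) (pad k lam2)"
    unfolding R' pad using 1(3,4) 2(3) dom[unfolded pad]
    by (intro parabolic_kostka_append) (simp_all add: length_concat m_def k_def)
  finally show "rect_kostka lam R = rect_kostka lam1 R1 * rect_kostka lam2 R2"
    using 1(2) 2(2) by simp
qed

theorem mainTheorem4:
  shows "\<forall>P\<in>liskova. \<forall>Q\<in>liskova. P * Q \<in> liskova"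
proof (intro ballI)
  fix P Q assume PQ: "P \<in> liskova" "Q \<in> liskova"
  let ?F = "\<lambda>P. fps_to_fls (fps_of_poly (map_poly int P))"
  from PQ(1) obtain lam1 R1 l1 where P: "coeff P 0 \<noteq> 0" "is_partition lam1" "dominant_rectangles R1"
    "?F P = fls_X_intpow l1 * fps_to_fls (rect_kostka lam1 R1)"
    unfolding liskova_def PK_realizable_def mem_Collect_eq by blast
  from PQ(2) obtain lam2 R2 l2 where Q: "coeff Q 0 \<noteq> 0" "is_partition lam2" "dominant_rectangles R2"
    "?F Q = fls_X_intpow l2 * fps_to_fls (rect_kostka lam2 R2)"
    unfolding liskova_def PK_realizable_def mem_Collect_eq by blast
  have nz: "?F P \<noteq> 0" if "coeff P 0 \<noteq> 0" for P
    using that by (simp add: fps_to_fls_eq_0_iff poly_eq_iff coeff_map_poly) (metis of_nat_eq_0_iff)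
  have "rect_kostka lam1 R1 \<noteq> 0" "rect_kostka lam2 R2 \<noteq> 0"
    using nz[OF P(1)] nz[OF Q(1)] P(4) Q(4) by auto
  then obtain lam R where lam: "is_partition lam" "dominant_rectangles R"
    "rect_kostka lam R = rect_kostka lam1 R1 * rect_kostka lam2 R2"
    using rect_kostka_mult P(2,3) Q(2,3) by blast
  have "map_poly int (P * Q) = map_poly int P * map_poly int Q"
    by (rule poly_eqI) (simp add: coeff_map_poly coeff_mult)
  then have "?F (P * Q) = ?F P * ?F Q"
    by (simp add: fps_of_poly_mult fls_times_fps_to_fls)
  also have "\<dots> = fls_X_intpow (l1 + l2) * fps_to_fls (rect_kostka lam R)"
    unfolding P(4) Q(4) lam(3) fls_times_fps_to_fls fls_X_intpow_times_fls_X_intpow[symmetric]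
    by (simp only: mult_ac)
  finally have "?F (P * Q) = fls_X_intpow (l1 + l2) * fps_to_fls (rect_kostka lam R)" .
  moreover have "coeff (P * Q) 0 \<noteq> 0" using P(1) Q(1) by (simp add: coeff_mult)
  ultimately show "P * Q \<in> liskova"
    using lam(1,2) unfolding liskova_def PK_realizable_def by blast
qed

end
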